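(* Let $c_0,c_1>0$, $\tau=\frac{c_0+c_1}2$, $\overline\tau=\frac{c_1-c_0}2$ and $t>0$. 1) $\mathbb P(N^{c_0,c_1}_t=0)=e^{-tc_0}$, and given $N^{c_0,c_1}_t=0$ we have $Z^{c_0,c_1}_t=t$. 2) For every integer $k\ge1$, $$\mathbb P(N^{c_0,c_1}_t=2k)=\frac{(c_0c_1)^k\alpha_k(t)}{2^{2k}k!(k-1)!}\,e^{-\tau t}\quad\text{with}\quad \alpha_k(t)=\int_{-t}^t(t-z)^{k-1}(t+z)^ke^{\overline\tau z}dz,$$ and the conditional distribution of $Z^{c_0,c_1}_t$ is given by $$\mathbb P(Z^{c_0,c_1}_t\in dz\mid N^{c_0,c_1}_t=2k)=\frac1{\alpha_k(t)}(t-z)^{k-1}(t+z)^ke^{\overline\tau z}1_{[-t,t]}(z)\,dz .$$ 3) For every integer $k\ge0$, $$\mathbb P(N^{c_0,c_1}_t=2k+1)=\frac{c_0^{k+1}c_1^k\tilde\alpha_k(t)}{2^{2k+1}(k!)^2}\,e^{-\tau t}\quad\text{with}\quad\tilde\alpha_k(t)=\int_{-t}^t(t-z)^k(t+z)^ke^{\overline\tau z}dz,$$ and the conditional distribution of $Z^{c_0,c_1}_t$ is given by $$\mathbb P(Z^{c_0,c_1}_t\in dz\mid N^{c_0,c_1}_t=2k+1)=\frac1{\tilde\alpha_k(t)}(t-z)^k(t+z)^ke^{\overline\tau z}1_{[-t,t]}(z)\,dz .$$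
   Context: Let $(e_n)_{n\ge1}$ be i.i.d. exponential random variables with $\mathbb E[e_n]=1$, let $\lambda_k=1/c_0$ if $k$ is odd and $\lambda_k=1/c_1$ if $k$ is even, and set $$N^{c_0,c_1}_t=\sum_{k\ge1}1_{\{\lambda_1e_1+\dots+\lambda_ke_k\le t\}},\qquad Z^{c_0,c_1}_t=\int_0^t(-1)^{N^{c_0,c_1}_u}\,du,\qquad t\ge0.$$ *)

theory Defs
  imports "HOL-Probability.Probability"
begin

text \<open>
  The waiting times \<open>e\<^sub>1, e\<^sub>2, \<dots>\<close> are \<open>e 1, e 2, \<dots>\<close>; the value \<open>e 0\<close> is never used.
\<close>

definition wait_scale :: "real \<Rightarrow> real \<Rightarrow> nat \<Rightarrow> real" where
  "wait_scale c0 c1 k = (if odd k then 1 / c0 else 1 / c1)"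

text \<open>
  The series is taken in \<^typ>\<open>enat\<close>, where it always converges, so that on the null event where
  infinitely many jumps occur before time \<open>t\<close> the count is \<open>\<infinity>\<close> and not a spurious finite number.
  The summation index is shifted by one: the term at \<open>k\<close> belongs to the jump number \<open>Suc k\<close>.
\<close>

definition jump_count ::
  "(nat \<Rightarrow> 'a \<Rightarrow> real) \<Rightarrow> real \<Rightarrow> real \<Rightarrow> real \<Rightarrow> 'a \<Rightarrow> enat" where
  "jump_count e c0 c1 t \<omega> =
     (\<Sum>k. of_bool ((\<Sum>i = 1..Suc k. wait_scale c0 c1 i * e i \<omega>) \<le> t))"

text \<open>The value of the sign at \<open>\<infinity>\<close> is immaterial, since the count is almost surely finite.\<close>

definition telegraph ::
  "(nat \<Rightarrow> 'a \<Rightarrow> real) \<Rightarrow> real \<Rightarrow> real \<Rightarrow> real \<Rightarrow> 'a \<Rightarrow> real" where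
  "telegraph e c0 c1 t \<omega> =
     (LBINT u:{0..t}. (-1) ^ the_enat (jump_count e c0 c1 u \<omega>))"

text \<open>The drift parameter \<open>b\<close> below is \<open>(c1 - c0) / 2\<close> in the application.\<close>

definition alpha :: "real \<Rightarrow> nat \<Rightarrow> real \<Rightarrow> real" where
  "alpha b k t = (LBINT z:{-t..t}. (t - z) ^ (k - 1) * (t + z) ^ k * exp (b * z))"

definition alpha_tilde :: "real \<Rightarrow> nat \<Rightarrow> real \<Rightarrow> real" where
  "alpha_tilde b k t = (LBINT z:{-t..t}. (t - z) ^ k * (t + z) ^ k * exp (b * z))"

text \<open>The conditional probability measure \<open>\<P>(\<cdot> | X = n)\<close>, for an event of positive probability.\<close>

definition given_value :: "'a measure \<Rightarrow> ('a \<Rightarrow> 'b) \<Rightarrow> 'b \<Rightarrow> 'a measure" where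
  "given_value M X n = uniform_measure M {\<omega> \<in> space M. X \<omega> = n}"

end

theory Submission
  imports Defs
begin

text \<open>
  Write \<open>X\<^sub>i = \<lambda>\<^sub>i e\<^sub>i\<close> for the holding times and \<open>S\<^sub>n = X\<^sub>1 + \<dots> + X\<^sub>n\<close> for the jump times, so
  that \<open>N\<^sub>t = n\<close> means \<open>S\<^sub>n \<le> t < S\<^sub>n\<^sub>+\<^sub>1\<close>.  The velocity is \<open>+1\<close> during odd-numbered holding times and
  \<open>-1\<close> during even-numbered ones.  Split \<open>S\<^sub>n = X + Y\<close>, where \<open>X\<close> collects the holding times whose
  index has the parity of \<open>n\<close> and \<open>Y\<close> the others.  At time \<open>t\<close> the path is inside holding time
  \<open>n + 1\<close>, which has the same velocity \<open>(-1)\<^sup>n\<close> as the holding times in \<open>Y\<close>.  The time spent with the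
  opposite velocity is therefore exactly \<open>X\<close>, and \<open>Z\<^sub>t = (-1)\<^sup>n (t - 2 X)\<close> (\<open>telegraph_eq\<close>).

  The summands of \<open>X\<close> have a common rate \<open>a\<close>, so for \<open>n \<ge> 1\<close> the variable \<open>X\<close> has an Erlang density.
  The summands of \<open>Y\<close> and the next holding time \<open>W = X\<^sub>n\<^sub>+\<^sub>1\<close> have a common rate \<open>b\<close> and are
  independent of \<open>X\<close>.  Given \<open>X = x\<close>, the event \<open>N\<^sub>t = n\<close> reads \<open>Y \<le> t - x < Y + W\<close>, that is, a
  Poisson process of rate \<open>b\<close> has as many points in \<open>[0, t - x]\<close> as \<open>Y\<close> has summands; its probability
  is a Poisson weight.  Hence the joint law of \<open>N\<^sub>t = n\<close> and \<open>X\<close> has as density the Erlang density at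
  \<open>x\<close> times the Poisson weight at \<open>t - x\<close> (\<open>emeasure_exponential_renewal\<close>).  No multiple integral
  occurs: the Poisson weight is the difference of two consecutive Erlang distribution functions.

  The substitution \<open>x = (t - (-1)\<^sup>n z) / 2\<close> turns this product into a constant times
  \<open>(t - (-1)\<^sup>n z)\<^sup>m (t + (-1)\<^sup>n z)\<^sup>j exp (\<tau>' z)\<close> on \<open>[-t, t]\<close>, with \<open>m + 1\<close> and
  \<open>j\<close> the numbers of summands of \<open>X\<close> and \<open>Y\<close> (\<open>nn_integral_erlang_gap_affine\<close>).  Its total
  mass is the probability of \<open>N\<^sub>t = n\<close>, and dividing by the mass gives the conditional density
  (\<open>given_value_distributed\<close>).  Even and odd \<open>n\<close> are the two instances of this one computation;
  only \<open>n = 0\<close>, where \<open>X\<close> is an empty sum without density, is separate.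
\<close>

section \<open>Paths of the counting process and of the telegraph process\<close>

text \<open>
  This needs care only when infinitely many \<open>S (Suc k)\<close> lie below \<open>u\<close>: the series then exceeds
  every finite number, so it cannot equal \<^term>\<open>enat n\<close>.
\<close>
lemma crossing_count_eq_iff:
  fixes S :: "nat \<Rightarrow> real"
  assumes S: "strict_mono S" and u: "S 0 \<le> u"
  shows "(\<Sum>k. of_bool (S (Suc k) \<le> u)) = enat n \<longleftrightarrow> S n \<le> u \<and> u < S (Suc n)"
proof -
  have count: "(\<Sum>k. of_bool (S (Suc k) \<le> u)) = enat m" if m: "S m \<le> u" "u < S (Suc m)" for m
  proof -
    have bool: "of_bool (S (Suc k) \<le> u) = (if k < m then 1 else 0 :: enat)" for k
    proof (cases "k < m")
      case True
      then have "S (Suc k) \<le> S m" using S by (simp add: strict_mono_less_eq)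
      then show ?thesis using m True by simp
    next
      case False
      then have "S (Suc m) \<le> S (Suc k)" using S by (simp add: strict_mono_less_eq)
      then show ?thesis using m False by simp
    qed
    have "(\<Sum>k. of_bool (S (Suc k) \<le> u)) = (\<Sum>k<m. of_bool (S (Suc k) \<le> u) :: enat)"
      by (rule suminf_finite) (auto simp: bool)
    also have "\<dots> = enat m" by (simp add: bool of_nat_eq_enat)
    finally show ?thesis .
  qed
  show ?thesis
  proof
    assume N: "(\<Sum>k. of_bool (S (Suc k) \<le> u)) = enat n"
    show "S n \<le> u \<and> u < S (Suc n)"
    proof (cases "\<exists>m. u < S (Suc m)")
      case True
      define m where "m = (LEAST m. u < S (Suc m))"
      have 1: "u < S (Suc m)" unfolding m_def using True by (rule LeastI_ex)
      have 2: "S m \<le> u"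
      proof (cases m)
        case (Suc j)
        then have "\<not> u < S (Suc j)" unfolding m_def by (metis lessI not_less_Least)
        then show ?thesis using Suc by simp
      qed (use u in simp)
      show ?thesis using count[OF 2 1] N 1 2 by simp
    next
      case False
      then have "S (Suc k) \<le> u" for k by (auto simp: not_less)
      then have "(\<Sum>k<Suc n. 1 :: enat) \<le> (\<Sum>k. of_bool (S (Suc k) \<le> u))"
        using sum_le_suminf[of "\<lambda>k. of_bool (S (Suc k) \<le> u) :: enat" "{..<Suc n}"] by simp
      then have False unfolding N by (simp add: of_nat_eq_enat eSuc_enat one_enat_def)
      then show ?thesis ..
    qed
  qed (use count in auto)
qed

text \<open>
  The integrand is a step function.  On a piece that ends at a jump time its value at the right
  endpoint is the next one; a single point does not affect the integral.
\<close>
lemma has_integral_alternating: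
  fixes S :: "nat \<Rightarrow> real"
  assumes S: "strict_mono S" and f: "\<And>m u. S m \<le> u \<Longrightarrow> u < S (Suc m) \<Longrightarrow> f u = (-1 :: real) ^ m"
  shows "S n \<le> t \<Longrightarrow> t \<le> S (Suc n) \<Longrightarrow>
    (f has_integral (\<Sum>i<n. (-1) ^ i * (S (Suc i) - S i)) + (-1) ^ n * (t - S n)) {S 0..t}"
proof (induction n arbitrary: t)
  case 0
  have "((\<lambda>_. 1) has_integral (t - S 0)) {S 0..t}"
    using has_integral_const_real[of "1 :: real" "S 0" t] 0 by simp
  then have "(f has_integral (t - S 0)) {S 0..t}"
    by (rule has_integral_spike_finite[of "{t}", rotated 2]) (use 0 f[of 0] in auto)
  then show ?case by simp
next
  case (Suc n)
  have "((\<lambda>_. (-1) ^ Suc n) has_integral ((-1) ^ Suc n * (t - S (Suc n)))) {S (Suc n)..t}"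
    using has_integral_const_real[of "(-1 :: real) ^ Suc n" "S (Suc n)" t] Suc.prems by (simp add: mult.commute)
  then have 1: "(f has_integral ((-1) ^ Suc n * (t - S (Suc n)))) {S (Suc n)..t}"
    by (rule has_integral_spike_finite[of "{t}", rotated 2]) (use Suc.prems f[of "Suc n"] in auto)
  have le: "S 0 \<le> S (Suc n)" "S n \<le> S (Suc n)" using S by (simp_all add: strict_mono_less_eq)
  from has_integral_combine[OF le(1) Suc.prems(1) Suc.IH[OF le(2) order_refl] 1] show ?case
    by (simp add: algebra_simps)
qed

text \<open>
  Expanding the bracket leaves the coefficient \<open>(-1) ^ (i - 1) - (-1) ^ n\<close> at \<open>y i\<close>: it is zero
  unless \<open>i\<close> has the parity of \<open>n\<close>, and \<open>- 2 * (-1) ^ n\<close> if it has.  So the displacement depends only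
  on the holding times with the velocity opposite to the current one.
\<close>
lemma alternating_sum_by_parity:
  fixes y :: "nat \<Rightarrow> real"
  shows "(\<Sum>i<n. (-1) ^ i * y (Suc i)) + (-1) ^ n * (t - (\<Sum>i = 1..n. y i)) =
    (-1) ^ n * (t - 2 * (\<Sum>i | i \<in> {1..n} \<and> even i = even n. y i))"
proof -
  have "(\<Sum>i<n. (-1) ^ i * y (Suc i)) - (-1) ^ n * (\<Sum>i = 1..n. y i) =
      (\<Sum>i<n. ((-1) ^ i - (-1) ^ n) * y (Suc i))"
    by (simp add: sum.atLeast1_atMost_eq sum_distrib_left left_diff_distrib sum_subtractf)
  also have "\<dots> = (\<Sum>i<n. - 2 * (-1) ^ n * (if even (Suc i) = even n then y (Suc i) else 0))"
    by (intro sum.cong) (auto simp: minus_one_power_iff)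
  also have "\<dots> = - 2 * (-1) ^ n * (\<Sum>i = 1..n. if even i = even n then y i else 0)"
    by (simp add: sum.atLeast1_atMost_eq sum_distrib_left)
  also have "(\<Sum>i = 1..n. if even i = even n then y i else 0) = (\<Sum>i | i \<in> {1..n} \<and> even i = even n. y i)"
    by (subst sum.inter_filter) auto
  finally show ?thesis by (simp add: algebra_simps)
qed

text \<open>
  The values are countably many, so measurability into the discrete space reduces to that of the
  fibres, and singletons are Borel in \<^typ>\<open>enat\<close>.
\<close>
lemma measurable_enat_count:
  assumes [measurable]: "\<And>k. Measurable.pred M (P k)"
  shows "(\<lambda>x. \<Sum>k. of_bool (P k x) :: enat) \<in> M \<rightarrow>\<^sub>M count_space UNIV"
proof -
  have "(\<lambda>x. if P k x then 1 else 0 :: enat) \<in> borel_measurable M" for k by measurable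
  then have "(\<lambda>x. \<Sum>k. of_bool (P k x) :: enat) \<in> borel_measurable M"
    by (intro borel_measurable_suminf_order) (simp add: of_bool_def)
  then have "(\<lambda>x. \<Sum>k. of_bool (P k x) :: enat) -` {n} \<inter> space M \<in> sets M" for n
    by (rule measurable_sets) simp
  then show ?thesis
    by (simp add: measurable_count_space_eq2_countable)
qed

text \<open>
  Time and sample point are both composed with measurable maps: joint measurability is what the
  integral over time in \<^const>\<open>telegraph\<close> requires.
\<close>
lemma measurable_jump_count:
  assumes "\<And>i. i \<ge> 1 \<Longrightarrow> e i \<in> borel_measurable M" "f \<in> borel_measurable N" "g \<in> N \<rightarrow>\<^sub>M M"
  shows "(\<lambda>x. jump_count e c0 c1 (f x) (g x)) \<in> N \<rightarrow>\<^sub>M count_space UNIV"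
proof -
  note [measurable] = assms(2,3)
  have "(\<lambda>x. e i (g x)) \<in> borel_measurable N" if "i \<ge> 1" for i
    using assms(1)[OF that] by measurable
  then have [measurable]: "(\<lambda>x. \<Sum>i = 1..Suc k. wait_scale c0 c1 i * e i (g x)) \<in> borel_measurable N" for k
    by (intro borel_measurable_sum borel_measurable_times) auto
  show ?thesis unfolding jump_count_def by (intro measurable_enat_count) measurable
qed

lemma measurable_telegraph:
  assumes e: "\<And>i. i \<ge> 1 \<Longrightarrow> e i \<in> borel_measurable M"
  shows "telegraph e c0 c1 t \<in> borel_measurable M"
proof -
  have [measurable]: "(\<lambda>x. jump_count e c0 c1 (snd x) (fst x)) \<in> M \<Otimes>\<^sub>M lborel \<rightarrow>\<^sub>M count_space UNIV"
    by (rule measurable_jump_count[OF e]) auto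
  have "(\<lambda>\<omega>. \<integral>u. indicator {0..t} u *\<^sub>R (-1 :: real) ^ the_enat (jump_count e c0 c1 u \<omega>) \<partial>lborel) \<in> borel_measurable M"
    by (rule lborel.borel_measurable_lebesgue_integral) (simp add: split_beta')
  then show ?thesis unfolding telegraph_def[abs_def] set_lebesgue_integral_def by simp
qed

text \<open>
  The total length of those among the first \<open>n\<close> holding times whose velocity is opposite to that of
  holding time \<open>n + 1\<close>.
\<close>
definition same_parity_time :: "(nat \<Rightarrow> 'a \<Rightarrow> real) \<Rightarrow> real \<Rightarrow> real \<Rightarrow> nat \<Rightarrow> 'a \<Rightarrow> real" where
  "same_parity_time e c0 c1 n \<omega> = (\<Sum>i | i \<in> {1..n} \<and> even i = even n. wait_scale c0 c1 i * e i \<omega>)"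

lemma wait_scale_pos: "c0 > 0 \<Longrightarrow> c1 > 0 \<Longrightarrow> wait_scale c0 c1 i > 0"
  by (simp add: wait_scale_def)

text \<open>
  These are statements about a single path with positive waiting times, which almost every path has;
  positivity makes the jump times strictly increasing.
\<close>
lemma
  assumes pos: "\<And>i. i \<ge> 1 \<Longrightarrow> e i \<omega> > 0" and c: "c0 > 0" "c1 > 0"
  shows jump_count_eq_iff: "u \<ge> 0 \<Longrightarrow> jump_count e c0 c1 u \<omega> = enat n \<longleftrightarrow>
      (\<Sum>i = 1..n. wait_scale c0 c1 i * e i \<omega>) \<le> u \<and> u < (\<Sum>i = 1..Suc n. wait_scale c0 c1 i * e i \<omega>)"
    and telegraph_eq: "t \<ge> 0 \<Longrightarrow> jump_count e c0 c1 t \<omega> = enat n \<Longrightarrow>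
      telegraph e c0 c1 t \<omega> = (-1) ^ n * (t - 2 * same_parity_time e c0 c1 n \<omega>)"
proof -
  define S where "S n = (\<Sum>i = 1..n. wait_scale c0 c1 i * e i \<omega>)" for n
  have S: "strict_mono S" unfolding S_def
    using pos wait_scale_pos[OF c] by (auto simp: strict_mono_Suc_iff)
  have S0: "S 0 = 0" by (simp add: S_def)
  have count: "jump_count e c0 c1 u \<omega> = enat n \<longleftrightarrow> S n \<le> u \<and> u < S (Suc n)" if "u \<ge> 0" for u n
    unfolding jump_count_def S_def[symmetric] using that S0 by (intro crossing_count_eq_iff[OF S]) simp
  then show "u \<ge> 0 \<Longrightarrow> jump_count e c0 c1 u \<omega> = enat n \<longleftrightarrow>
      (\<Sum>i = 1..n. wait_scale c0 c1 i * e i \<omega>) \<le> u \<and> u < (\<Sum>i = 1..Suc n. wait_scale c0 c1 i * e i \<omega>)"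
    by (simp only: S_def)
  define f where "f u = (-1 :: real) ^ the_enat (jump_count e c0 c1 u \<omega>)" for u
  assume t: "t \<ge> 0" and n: "jump_count e c0 c1 t \<omega> = enat n"
  have f: "f u = (-1) ^ m" if "S m \<le> u" "u < S (Suc m)" for m u
  proof -
    have "0 \<le> S m" using S S0 by (metis strict_mono_less_eq le0)
    then show ?thesis using that count[of u m] by (simp add: f_def)
  qed
  have tn: "S n \<le> t" "t \<le> S (Suc n)" using count[OF t, of n] n by auto
  have "(f has_integral (\<Sum>i<n. (-1) ^ i * (S (Suc i) - S i)) + (-1) ^ n * (t - S n)) {0..t}"
    using has_integral_alternating[OF S f tn] S0 by simp
  also have "(\<Sum>i<n. (-1) ^ i * (S (Suc i) - S i)) + (-1) ^ n * (t - S n) =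
      (-1) ^ n * (t - 2 * same_parity_time e c0 c1 n \<omega>)"
    unfolding same_parity_time_def alternating_sum_by_parity[symmetric] by (simp add: S_def)
  finally have int: "(f has_integral (-1) ^ n * (t - 2 * same_parity_time e c0 c1 n \<omega>)) {0..t}" .
  \<comment> \<open>The fixed path is viewed as a constant random element, so that only time varies.\<close>
  have "(\<lambda>u. jump_count (\<lambda>i (_ :: real). e i \<omega>) c0 c1 u 0) \<in> borel \<rightarrow>\<^sub>M count_space UNIV"
    by (rule measurable_jump_count[where M = borel]) auto
  then have "(\<lambda>u. jump_count e c0 c1 u \<omega>) \<in> borel \<rightarrow>\<^sub>M count_space UNIV"
    unfolding jump_count_def .
  then have [measurable]: "f \<in> borel_measurable borel" unfolding f_def by measurable
  have "norm (f u) \<le> 1" for u by (simp add: f_def power_abs)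
  then have "set_integrable lborel {0..t} f"
    unfolding set_integrable_def
    by (intro integrableI_bounded_set_indicator[where B=1]) (use t in auto)
  then have "(LBINT u:{0..t}. f u) = integral {0..t} f"
    by (rule set_borel_integral_eq_integral)
  also have "\<dots> = (-1) ^ n * (t - 2 * same_parity_time e c0 c1 n \<omega>)"
    using int by (rule integral_unique)
  finally show "telegraph e c0 c1 t \<omega> = (-1) ^ n * (t - 2 * same_parity_time e c0 c1 n \<omega>)"
    by (simp add: telegraph_def f_def)
qed

section \<open>Sums of independent exponential variables around a fixed time\<close>

lemma (in prob_space) indep_var_disjoint_sums:
  fixes X :: "'i \<Rightarrow> 'a \<Rightarrow> real"
  assumes "indep_vars (\<lambda>_. borel) X K" "I \<subseteq> K" "J \<subseteq> K" "I \<inter> J = {}" "finite I" "finite J"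
  shows "indep_var borel (\<lambda>\<omega>. \<Sum>i\<in>I. X i \<omega>) borel (\<lambda>\<omega>. \<Sum>i\<in>J. X i \<omega>)"
proof -
  have ind: "indep_vars (\<lambda>_. borel) X (I \<union> J)" by (rule indep_vars_subset[OF assms(1)]) (use assms in auto)
  have "indep_var borel ((\<lambda>f. \<Sum>i\<in>I. f i) \<circ> (\<lambda>\<omega>. restrict (\<lambda>i. X i \<omega>) I))
      borel ((\<lambda>f. \<Sum>i\<in>J. f i) \<circ> (\<lambda>\<omega>. restrict (\<lambda>i. X i \<omega>) J))"
    by (intro indep_var_compose[OF indep_var_restrict[OF ind]]) (use assms in auto)
  then show ?thesis by (simp add: comp_def cong: sum.cong)
qed

text \<open>
  By independence the joint law of \<open>X\<close> and \<open>Y\<close> is a product measure, and the right-hand side is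
  Fubini's theorem with \<open>X\<close> as the outer variable.
\<close>
lemma (in prob_space) emeasure_indep_var_sum_le:
  fixes X Y :: "'a \<Rightarrow> real"
  assumes ind: "indep_var borel X borel Y" and X: "distributed M lborel X f"
    and B[measurable]: "B \<in> sets borel"
  shows "emeasure M {\<omega> \<in> space M. X \<omega> \<in> B \<and> X \<omega> + Y \<omega> \<le> t} =
    (\<integral>\<^sup>+x. f x * emeasure M {\<omega> \<in> space M. Y \<omega> \<le> t - x} * indicator B x \<partial>lborel)"
proof -
  have [measurable]: "random_variable borel X" "random_variable borel Y"
    using indep_var_rv1[OF ind] indep_var_rv2[OF ind] by auto
  have f[measurable]: "f \<in> borel_measurable borel" using X by (simp add: distributed_def)
  have dX: "distr M borel X = density lborel f"
    using X by (simp add: distributed_def cong: distr_cong)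
  have dY: "emeasure (distr M borel Y) {..s} = emeasure M {\<omega> \<in> space M. Y \<omega> \<le> s}" for s
    by (subst emeasure_distr) (auto intro!: arg_cong[where f="emeasure M"])
  interpret Y: prob_space "distr M borel Y" by (rule prob_space_distr) simp
  define A where "A = {p \<in> space (borel \<Otimes>\<^sub>M borel). fst p \<in> B \<and> fst p + snd p \<le> (t :: real)}"
  have A[measurable]: "A \<in> sets (borel \<Otimes>\<^sub>M borel)" unfolding A_def by measurable
  have A': "A \<in> sets (distr M borel X \<Otimes>\<^sub>M distr M borel Y)" using A by simp
  have Px: "Pair x -` A = (if x \<in> B then {..t - x} else {})" for x :: real
    by (auto simp: A_def space_pair_measure)
  have m: "(\<lambda>x. emeasure (distr M borel Y) {..t - x}) \<in> borel_measurable borel"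
  proof -
    have "(\<lambda>x. emeasure (distr M borel Y) {..t - x}) =
        (\<lambda>x. emeasure (distr M borel Y) (Pair x -` {p \<in> space (borel \<Otimes>\<^sub>M borel). fst p + snd p \<le> t}))"
      by (rule ext, rule arg_cong[where f="emeasure (distr M borel Y)"]) (auto simp: space_pair_measure)
    also have "\<dots> \<in> borel_measurable borel"
      by (rule Y.measurable_emeasure_Pair) measurable
    finally show ?thesis .
  qed
  have "emeasure M {\<omega> \<in> space M. X \<omega> \<in> B \<and> X \<omega> + Y \<omega> \<le> t} =
      emeasure (distr M (borel \<Otimes>\<^sub>M borel) (\<lambda>\<omega>. (X \<omega>, Y \<omega>))) A"
    by (subst emeasure_distr[OF _ A])
      (auto intro!: arg_cong[where f="emeasure M"] simp: A_def space_pair_measure)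
  also have "\<dots> = emeasure (distr M borel X \<Otimes>\<^sub>M distr M borel Y) A"
    using ind by (simp add: indep_var_distribution_eq)
  also have "\<dots> = (\<integral>\<^sup>+x. emeasure (distr M borel Y) (Pair x -` A) \<partial>distr M borel X)"
    by (rule Y.emeasure_pair_measure_alt[OF A'])
  also have "\<dots> = (\<integral>\<^sup>+x. emeasure (distr M borel Y) {..t - x} * indicator B x \<partial>density lborel f)"
    unfolding dX by (intro nn_integral_cong) (auto simp: Px)
  also have "\<dots> = (\<integral>\<^sup>+x. f x * (emeasure (distr M borel Y) {..t - x} * indicator B x) \<partial>lborel)"
    by (rule nn_integral_density) (use m in auto)
  also have "\<dots> = (\<integral>\<^sup>+x. f x * emeasure M {\<omega> \<in> space M. Y \<omega> \<le> t - x} * indicator B x \<partial>lborel)"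
    by (simp add: dY mult.assoc)
  finally show ?thesis .
qed

text \<open>
  For nonempty \<open>J\<close> this is the Erlang distribution function with shape \<^term>\<open>card J\<close>.  Written as a
  sum over \<open>m < card J\<close>, the formula also covers the empty sum, which is \<open>0\<close>; this case occurs for a
  single jump.
\<close>
lemma (in prob_space) emeasure_exponential_sum_le:
  assumes J: "finite J" and b: "b > 0"
    and exp: "\<And>i. i \<in> J \<Longrightarrow> distributed M lborel (X i) (exponential_density b)"
    and ind: "indep_vars (\<lambda>_. borel) X J"
  shows "emeasure M {\<omega> \<in> space M. (\<Sum>i\<in>J. X i \<omega>) \<le> s} =
    ennreal (if s < 0 then 0 else 1 - (\<Sum>m<card J. (b * s) ^ m * exp (- b * s) / fact m))"
proof (cases "J = {}")
  case True
  then show ?thesis by (simp add: emeasure_space_1)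
next
  case False
  have D: "distributed M lborel (\<lambda>\<omega>. \<Sum>i\<in>J. X i \<omega>) (erlang_density (card J - 1) b)"
    by (rule exponential_distributed_sum[OF J False b exp ind])
  have [measurable]: "random_variable borel (\<lambda>\<omega>. \<Sum>i\<in>J. X i \<omega>)" using distributed_measurable[OF D] by simp
  have "emeasure M {\<omega> \<in> space M. (\<Sum>i\<in>J. X i \<omega>) \<le> s} =
      emeasure (distr M lborel (\<lambda>\<omega>. \<Sum>i\<in>J. X i \<omega>)) {..s}"
    by (subst emeasure_distr) (auto intro!: arg_cong[where f="emeasure M"])
  also have "\<dots> = erlang_CDF (card J - 1) b s"
    unfolding distributed_distr_eq_density[OF D] by (rule emeasure_erlang_density[OF b])
  finally have "emeasure M {\<omega> \<in> space M. (\<Sum>i\<in>J. X i \<omega>) \<le> s} = erlang_CDF (card J - 1) b s" .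
  moreover have "{..card J - 1} = {..<card J}"
    using False J by (cases "card J") auto
  ultimately show ?thesis by (simp add: erlang_CDF_def)
qed

text \<open>
  Consecutive Erlang distribution functions differ by one Poisson weight, the last term of the sum
  in \<open>emeasure_exponential_sum_le\<close>.
\<close>
lemma (in prob_space) emeasure_exponential_sum_le_insert:
  assumes J: "finite J" "w \<notin> J" and b: "b > 0"
    and exp: "\<And>i. i \<in> insert w J \<Longrightarrow> distributed M lborel (X i) (exponential_density b)"
    and ind: "indep_vars (\<lambda>_. borel) X (insert w J)"
  shows "emeasure M {\<omega> \<in> space M. (\<Sum>i\<in>J. X i \<omega>) \<le> s} =
    ennreal (if s < 0 then 0 else (b * s) ^ card J * exp (- b * s) / fact (card J)) +
    emeasure M {\<omega> \<in> space M. (\<Sum>i\<in>insert w J. X i \<omega>) \<le> s}"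
proof -
  have 1: "emeasure M {\<omega> \<in> space M. (\<Sum>i\<in>J. X i \<omega>) \<le> s} =
    ennreal (if s < 0 then 0 else 1 - (\<Sum>m<card J. (b * s) ^ m * exp (- b * s) / fact m))"
    using J b exp by (intro emeasure_exponential_sum_le indep_vars_subset[OF ind]) auto
  have 2: "emeasure M {\<omega> \<in> space M. (\<Sum>i\<in>insert w J. X i \<omega>) \<le> s} =
    ennreal (if s < 0 then 0 else 1 - (\<Sum>m<card (insert w J). (b * s) ^ m * exp (- b * s) / fact m))"
    using J by (intro emeasure_exponential_sum_le[OF _ b exp ind]) auto
  have nonneg: "0 \<le> 1 - (\<Sum>m<card (insert w J). (b * s) ^ m * exp (- b * s) / fact m)" if "0 \<le> s"
  proof -
    have "0 \<le> erlang_CDF (card J) b s" by (rule erlang_CDF_nonneg[OF b])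
    with that show ?thesis using J by (simp add: erlang_CDF_def lessThan_Suc_atMost)
  qed
  show ?thesis
  proof (cases "s < 0")
    case False
    then show ?thesis
      unfolding 1 2 using J b nonneg by (subst ennreal_plus[symmetric]) auto
  qed (simp add: 1 2)
qed

text \<open>
  Since \<open>X w > 0\<close> almost surely, the event is the difference of the events \<open>X + Y \<le> t\<close> and
  \<open>X + Y + W \<le> t\<close>, each restricted to \<open>X \<in> B\<close>, with \<open>X\<close>, \<open>Y\<close> the sums over \<open>I\<close>, \<open>J\<close> and \<open>W = X w\<close>.  Each of
  them involves only two independent variables, \<open>X\<close> and a sum of rate \<open>b\<close>, and the difference of the
  two integrands is the Poisson weight at \<open>t - x\<close>.
\<close>
lemma (in prob_space) emeasure_exponential_renewal:
  assumes fin: "finite I" "finite J" and ne: "I \<noteq> {}" and disj: "I \<inter> J = {}" "w \<notin> I" "w \<notin> J"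
    and a: "a > 0" and b: "b > 0"
    and expI: "\<And>i. i \<in> I \<Longrightarrow> distributed M lborel (X i) (exponential_density a)"
    and expJ: "\<And>i. i \<in> insert w J \<Longrightarrow> distributed M lborel (X i) (exponential_density b)"
    and ind: "indep_vars (\<lambda>_. borel) X (I \<union> insert w J)"
    and B[measurable]: "B \<in> sets borel"
  shows "emeasure M {\<omega> \<in> space M. (\<Sum>i\<in>I. X i \<omega>) \<in> B \<and>
      (\<Sum>i\<in>I. X i \<omega>) + (\<Sum>i\<in>J. X i \<omega>) \<le> t \<and> t < (\<Sum>i\<in>I. X i \<omega>) + (\<Sum>i\<in>insert w J. X i \<omega>)} =
    (\<integral>\<^sup>+x. ennreal (erlang_density (card I - 1) a x *
      (if t < x then 0 else (b * (t - x)) ^ card J * exp (- b * (t - x)) / fact (card J))) *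
      indicator B x \<partial>lborel)"
    (is "emeasure M ?E = integral\<^sup>N lborel (\<lambda>x. ennreal (?f x * ?p x) * _)")
proof -
  have rv: "random_variable borel (X i)" if "i \<in> I \<union> insert w J" for i
    using ind that by (auto simp: indep_vars_def)
  have [measurable]: "random_variable borel (\<lambda>\<omega>. \<Sum>i\<in>I. X i \<omega>)" "random_variable borel (\<lambda>\<omega>. \<Sum>i\<in>J. X i \<omega>)"
    "random_variable borel (\<lambda>\<omega>. \<Sum>i\<in>insert w J. X i \<omega>)"
    using rv by (auto intro!: borel_measurable_sum)
  define F where "F K = {\<omega> \<in> space M. (\<Sum>i\<in>I. X i \<omega>) \<in> B \<and> (\<Sum>i\<in>I. X i \<omega>) + (\<Sum>i\<in>K. X i \<omega>) \<le> t}" for K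
  define G where "G K x = emeasure M {\<omega> \<in> space M. (\<Sum>i\<in>K. X i \<omega>) \<le> t - x}" for K x
  have mF[measurable]: "F J \<in> events" "F (insert w J) \<in> events" unfolding F_def by measurable
  have F: "emeasure M (F K) = (\<integral>\<^sup>+x. ?f x * G K x * indicator B x \<partial>lborel)"
    if "K = J \<or> K = insert w J" for K
    unfolding F_def G_def
    using that fin disj ne
    by (intro emeasure_indep_var_sum_le indep_var_disjoint_sums[OF ind]
      exponential_distributed_sum[OF _ _ a expI] indep_vars_subset[OF ind]) auto
  have "indep_vars (\<lambda>_. borel) X (insert w J)" by (rule indep_vars_subset[OF ind]) auto
  from emeasure_exponential_sum_le_insert[OF fin(2) disj(3) b expJ this]
  have G: "G J x = ennreal (?p x) + G (insert w J) x" for x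
    unfolding G_def by simp
  have mG: "G (insert w J) \<in> borel_measurable borel"
  proof -
    have "G (insert w J) = (\<lambda>x. ennreal (if t - x < 0 then 0 else
        1 - (\<Sum>m<card (insert w J). (b * (t - x)) ^ m * exp (- b * (t - x)) / fact m)))"
      unfolding G_def using fin b expJ
      by (intro ext emeasure_exponential_sum_le indep_vars_subset[OF ind]) auto
    also have "\<dots> \<in> borel_measurable borel" by measurable
    finally show ?thesis .
  qed
  note [measurable] = mG
  have mE: "?E \<in> events" by measurable
  have "AE \<omega> in M. 0 < X w \<omega>"
    using exponential_distributedD_gt[OF expJ[of w] order_refl b] rv[of w] by (subst prob_Collect_eq_1[symmetric]) auto
  then have "AE \<omega> in M. \<omega> \<in> F J \<longleftrightarrow> \<omega> \<in> ?E \<union> F (insert w J)"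
    by (elim eventually_mono) (use fin disj in \<open>auto simp: F_def\<close>)
  then have "emeasure M (F J) = emeasure M (?E \<union> F (insert w J))"
    by (rule emeasure_eq_AE) (use mE mF in auto)
  also have "\<dots> = emeasure M ?E + emeasure M (F (insert w J))"
    using mE mF by (intro plus_emeasure[symmetric]) (auto simp: F_def)
  finally have split: "emeasure M ?E + emeasure M (F (insert w J)) = emeasure M (F J)" ..
  also have "\<dots> = (\<integral>\<^sup>+x. ennreal (?f x * ?p x) * indicator B x + ?f x * G (insert w J) x * indicator B x \<partial>lborel)"
    unfolding F[OF disjI1[OF refl]] G
    using a b by (intro nn_integral_cong) (auto simp: ennreal_mult distrib_left distrib_right)
  also have "\<dots> = (\<integral>\<^sup>+x. ennreal (?f x * ?p x) * indicator B x \<partial>lborel) + emeasure M (F (insert w J))"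
    unfolding F[OF disjI2[OF refl]] by (rule nn_integral_add) measurable
  finally show ?thesis by simp
qed

section \<open>From the sojourn time to the position\<close>

text \<open>
  The substitution is \<open>x = (t - s z) / 2\<close>, so that \<open>t - x = (t + s z) / 2\<close> and \<open>s (t - 2 x) = z\<close>
  because \<open>s\<^sup>2 = 1\<close>.  The constraints \<open>0 \<le> x \<le> t\<close> become \<open>-t \<le> z \<le> t\<close>, the exponentials combine to
  \<open>exp (- (a + b) t / 2) exp (s (a - b) z / 2)\<close>, and the powers of \<open>2\<close> come from the \<open>m + j\<close> factors
  and the Jacobian \<open>1/2\<close>.
\<close>
lemma nn_integral_erlang_gap_affine:
  assumes s: "s = 1 \<or> s = -1" and A[measurable]: "A \<in> sets borel"
  shows "(\<integral>\<^sup>+x. ennreal (erlang_density m a x *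
      (if t < x then 0 else (b * (t - x)) ^ j * exp (- b * (t - x)) / fact j)) *
      indicator {x. s * (t - 2 * x) \<in> A} x \<partial>lborel) =
    (\<integral>\<^sup>+z. ennreal (a ^ Suc m * b ^ j / (2 ^ (m + j + 1) * fact m * fact j) * exp (- (a + b) / 2 * t) *
      (indicator {-t..t} z * ((t - s * z) ^ m * (t + s * z) ^ j * exp (s * (a - b) / 2 * z)))) *
      indicator A z \<partial>lborel)"
    (is "integral\<^sup>N lborel ?F = integral\<^sup>N lborel ?H")
proof -
  have F[measurable]: "?F \<in> borel_measurable borel" by measurable
  have pt: "ennreal \<bar>- s / 2\<bar> * ?F (t / 2 + (- s / 2) * z) = ?H z" for z
  proof -
    define x where "x = t / 2 + (- s / 2) * z"
    have x: "x = (t - s * z) / 2" "t - x = (t + s * z) / 2" by (simp_all add: x_def field_simps)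
    have "s * (t - 2 * x) = z" using s by (auto simp: x field_simps)
    then have ind: "indicator {x. s * (t - 2 * x) \<in> A} x = (indicator A z :: ennreal)"
      by (simp add: indicator_def)
    show ?thesis
    proof (cases "z \<in> {-t..t}")
      case False
      then have "x < 0 \<or> t < x" using s x_def by auto
      then have "?F x = 0" by (auto simp: erlang_density_def)
      then show ?thesis unfolding x_def[symmetric] using False by simp
    next
      case True
      then have r: "0 \<le> x" "x \<le> t" using s x_def by auto
      have e: "exp (- a * x) * exp (- b * (t - x)) = exp (- (a + b) / 2 * t) * exp (s * (a - b) / 2 * z)"
        unfolding exp_add[symmetric] x by (rule arg_cong[where f=exp]) (simp add: field_simps)
      have "1 / 2 * (erlang_density m a x * ((b * (t - x)) ^ j * exp (- b * (t - x)) / fact j)) =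
          1 / 2 * a ^ Suc m * x ^ m / fact m * (b ^ j * (t - x) ^ j) / fact j * (exp (- a * x) * exp (- b * (t - x)))"
        using r by (simp add: erlang_density_def power_mult_distrib mult_ac)
      also have "\<dots> = a ^ Suc m * b ^ j / (2 ^ (m + j + 1) * fact m * fact j) * exp (- (a + b) / 2 * t) *
          ((t - s * z) ^ m * (t + s * z) ^ j * exp (s * (a - b) / 2 * z))"
        unfolding e unfolding x by (simp add: power_divide power_add field_simps)
      finally have eq: "1 / 2 * (erlang_density m a x * ((b * (t - x)) ^ j * exp (- b * (t - x)) / fact j)) = \<dots>" .
      have "ennreal \<bar>- s / 2\<bar> * ?F x = ennreal (1 / 2) *
          (ennreal (erlang_density m a x * ((b * (t - x)) ^ j * exp (- b * (t - x)) / fact j)) * indicator A z)"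
        using s r unfolding ind by auto
      also have "\<dots> = ennreal (1 / 2 * (erlang_density m a x * ((b * (t - x)) ^ j * exp (- b * (t - x)) / fact j))) *
          indicator A z"
        by (subst ennreal_mult') (simp_all only: mult.assoc)
      also have "\<dots> = ?H z" unfolding eq using True by simp
      finally show ?thesis unfolding x_def[symmetric] .
    qed
  qed
  have "integral\<^sup>N lborel ?F = ennreal \<bar>- s / 2\<bar> * (\<integral>\<^sup>+z. ?F (t / 2 + (- s / 2) * z) \<partial>lborel)"
    using s by (intro nn_integral_real_affine F) auto
  also have "\<dots> = (\<integral>\<^sup>+z. ennreal \<bar>- s / 2\<bar> * ?F (t / 2 + (- s / 2) * z) \<partial>lborel)"
    by (rule nn_integral_cmult[symmetric]) measurable
  also have "\<dots> = integral\<^sup>N lborel ?H" unfolding pt ..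
  finally show ?thesis .
qed

text \<open>
  The measure \<open>A \<mapsto> \<P>(N = n, Z \<in> A)\<close> has density \<open>C g\<close>.  Its total mass is the probability of the
  conditioning event, and in the quotient \<open>C\<close> cancels.
\<close>
lemma (in prob_space) given_value_distributed:
  fixes Z :: "'a \<Rightarrow> real"
  assumes N[measurable]: "N \<in> M \<rightarrow>\<^sub>M count_space UNIV" and Z[measurable]: "random_variable borel Z"
    and C: "C > 0" and g: "integrable lborel g" "\<And>z. g z \<ge> 0" and I: "(\<integral>z. g z \<partial>lborel) > 0"
    and law: "\<And>A. A \<in> sets borel \<Longrightarrow> emeasure M {\<omega> \<in> space M. N \<omega> = n \<and> Z \<omega> \<in> A} =
      (\<integral>\<^sup>+z. ennreal (C * g z) * indicator A z \<partial>lborel)"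
  shows "\<P>(\<omega> in M. N \<omega> = n) = C * (\<integral>z. g z \<partial>lborel)"
    and "distributed (given_value M N n) lborel Z (\<lambda>z. ennreal (g z / (\<integral>z. g z \<partial>lborel)))"
proof -
  define I where "I = (\<integral>z. g z \<partial>lborel)"
  define E where "E = {\<omega> \<in> space M. N \<omega> = n}"
  have E[measurable]: "E \<in> events" unfolding E_def by measurable
  have [measurable]: "g \<in> borel_measurable borel" using g(1) by auto
  have "I > 0" using I by (simp add: I_def)
  have mass: "emeasure M E = ennreal (C * I)"
  proof -
    have "emeasure M E = (\<integral>\<^sup>+z. ennreal (C * g z) \<partial>lborel)" using law[of UNIV] by (simp add: E_def)
    also have "\<dots> = ennreal (\<integral>z. C * g z \<partial>lborel)" using g C by (intro nn_integral_eq_integral) auto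
    finally show ?thesis by (simp add: I_def)
  qed
  then show "\<P>(\<omega> in M. N \<omega> = n) = C * (\<integral>z. g z \<partial>lborel)"
    using C \<open>I > 0\<close> unfolding E_def[symmetric] I_def[symmetric] by (simp add: measure_def)
  have "distr (uniform_measure M E) lborel Z = density lborel (\<lambda>z. ennreal (g z / I))"
  proof (rule measure_eqI)
    fix A assume "A \<in> sets (distr (uniform_measure M E) lborel Z)"
    then have A[measurable]: "A \<in> sets borel" by simp
    have "emeasure (distr (uniform_measure M E) lborel Z) A = emeasure (uniform_measure M E) (Z -` A \<inter> space M)"
      by (subst emeasure_distr) (auto simp: measurable_def)
    also have "\<dots> = emeasure M (E \<inter> (Z -` A \<inter> space M)) / emeasure M E"
      by (rule emeasure_uniform_measure) auto
    also have "E \<inter> (Z -` A \<inter> space M) = {\<omega> \<in> space M. N \<omega> = n \<and> Z \<omega> \<in> A}" by (auto simp: E_def)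
    also have "emeasure M \<dots> = (\<integral>\<^sup>+z. ennreal (C * I) * (ennreal (g z / I) * indicator A z) \<partial>lborel)"
      unfolding law[OF A] using C \<open>I > 0\<close> g(2)
      by (intro nn_integral_cong) (simp add: ennreal_mult[symmetric] mult.assoc[symmetric])
    also have "\<dots> = ennreal (C * I) * emeasure (density lborel (\<lambda>z. ennreal (g z / I))) A"
      by (subst nn_integral_cmult) (auto simp: emeasure_density)
    also have "\<dots> / emeasure M E = emeasure (density lborel (\<lambda>z. ennreal (g z / I))) A"
      unfolding mass using C \<open>I > 0\<close>
      by (subst mult.commute, intro ennreal_mult_divide_eq) auto
    finally show "emeasure (distr (uniform_measure M E) lborel Z) A = emeasure (density lborel (\<lambda>z. ennreal (g z / I))) A" .
  qed simp
  then show "distributed (given_value M N n) lborel Z (\<lambda>z. ennreal (g z / (\<integral>z. g z \<partial>lborel)))"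
    unfolding distributed_def given_value_def E_def[symmetric] I_def[symmetric] by simp
qed

lemma integral_pos_of_pos_on_interval:
  fixes h :: "real \<Rightarrow> real"
  assumes t: "t > 0" and h: "continuous_on {-t..t} h" "\<And>z. z \<in> {-t..t} \<Longrightarrow> h z \<ge> 0" "\<And>z. z \<in> {-t<..<t} \<Longrightarrow> h z > 0"
  shows "integrable lborel (\<lambda>z. indicator {-t..t} z * h z)" "(\<integral>z. indicator {-t..t} z * h z \<partial>lborel) > 0"
proof -
  show int: "integrable lborel (\<lambda>z. indicator {-t..t} z * h z)"
    using borel_integrable_atLeastAtMost'[OF h(1)] by (simp add: set_integrable_def)
  have nn: "AE z in lborel. 0 \<le> indicator {-t..t} z * h z" using h(2) by (auto split: split_indicator)
  have "(\<integral>z. indicator {-t..t} z * h z \<partial>lborel) \<noteq> 0"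
  proof
    assume "(\<integral>z. indicator {-t..t} z * h z \<partial>lborel) = 0"
    then have "AE z in lborel. indicator {-t..t} z * h z = 0"
      by (simp add: integral_nonneg_eq_0_iff_AE[OF int nn])
    then have "AE z in lborel. z \<notin> {-t<..<t}"
      by (elim eventually_mono) (use h(3) in \<open>force split: split_indicator_asm\<close>)
    then have "emeasure lborel {-t<..<t} = 0"
      by (subst (asm) AE_iff_measurable[of "{-t<..<t}"]) auto
    then show False using t by simp
  qed
  moreover have "(\<integral>z. indicator {-t..t} z * h z \<partial>lborel) \<ge> 0" by (rule integral_nonneg_AE[OF nn])
  ultimately show "(\<integral>z. indicator {-t..t} z * h z \<partial>lborel) > 0" by simp
qed

section \<open>The joint law of the number of jumps and the position\<close>

text \<open>
  When \<open>n\<close> increases by one the two classes are exchanged and the new index joins the first, so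
  the two counts have to be proved together.
\<close>
lemma card_same_parity:
  "card {i \<in> {1..n}. even i = even n} = Suc n div 2" "card {i \<in> {1..n}. even i \<noteq> even n} = n div 2"
proof (induction n)
  case (Suc n)
  have same: "{i \<in> {1..Suc n}. even i = even (Suc n)} = insert (Suc n) {i \<in> {1..n}. even i \<noteq> even n}"
    and other: "{i \<in> {1..Suc n}. even i \<noteq> even (Suc n)} = {i \<in> {1..n}. even i = even n}"
    by (auto simp: le_Suc_eq)
  {
    case 1 show ?case unfolding same using Suc by (subst card_insert_disjoint) auto
  next
    case 2 show ?case unfolding other using Suc by simp
  }
qed simp_all

lemma (in prob_space) AE_exponential_seq_pos:
  assumes exp1: "\<And>i. i \<ge> 1 \<Longrightarrow> distributed M lborel (e i) (exponential_density 1)"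
  shows "AE \<omega> in M. \<forall>i :: nat. i \<ge> 1 \<longrightarrow> 0 < e i \<omega>"
proof -
  have "AE \<omega> in M. 0 < e i \<omega>" if "i \<ge> 1" for i
    using exponential_distributedD_gt[OF exp1[OF that], of 0] distributed_measurable[OF exp1[OF that]]
    by (subst prob_Collect_eq_1[symmetric]) auto
  then show ?thesis by (simp add: AE_all_countable)
qed

text \<open>
  Almost surely all waiting times are positive, and then the event on the left is one about the sum
  over the indices of the parity of \<open>n\<close>, the sum over the remaining ones, and holding time \<open>n + 1\<close>.
  The rates \<open>a\<close> and \<open>b\<close> are those of the holding times \<open>n\<close> and \<open>n + 1\<close>, one for each parity.
\<close>
lemma (in prob_space) jump_count_telegraph_law:
  assumes ind: "indep_vars (\<lambda>_. borel) e {1..}"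
    and exp1: "\<And>i. i \<ge> 1 \<Longrightarrow> distributed M lborel (e i) (exponential_density 1)"
    and c: "c0 > 0" "c1 > 0" and t: "t > 0" and n: "n \<ge> 1"
    and a: "a = 1 / wait_scale c0 c1 n" and b: "b = 1 / wait_scale c0 c1 (Suc n)"
    and A[measurable]: "A \<in> sets borel"
  shows "emeasure M {\<omega> \<in> space M. jump_count e c0 c1 t \<omega> = enat n \<and> telegraph e c0 c1 t \<omega> \<in> A} =
    (\<integral>\<^sup>+x. ennreal (erlang_density (Suc n div 2 - 1) a x *
      (if t < x then 0 else (b * (t - x)) ^ (n div 2) * exp (- b * (t - x)) / fact (n div 2))) *
      indicator {x. (-1) ^ n * (t - 2 * x) \<in> A} x \<partial>lborel)"
proof -
  define X where "X i \<omega> = wait_scale c0 c1 i * e i \<omega>" for i \<omega>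
  define I where "I = {i \<in> {1..n}. even i = even n}"
  define J where "J = {i \<in> {1..n}. even i \<noteq> even n}"
  define B where "B = {x. (-1) ^ n * (t - 2 * x) \<in> A}"
  have B[measurable]: "B \<in> sets borel" unfolding B_def by measurable
  have e: "e i \<in> borel_measurable M" if "i \<ge> 1" for i
    using distributed_measurable[OF exp1[OF that]] by simp
  have expX: "distributed M lborel (X i) (exponential_density (1 / wait_scale c0 c1 i))" if "i \<ge> 1" for i
    using erlang_distributed_mult_const[OF exp1[OF that] wait_scale_pos[OF c]] by (simp add: X_def[abs_def])
  have "i \<ge> 1" "1 / wait_scale c0 c1 i = a" if "i \<in> I" for i
    using that by (simp_all add: I_def a wait_scale_def)
  with expX have expI: "distributed M lborel (X i) (exponential_density a)" if "i \<in> I" for i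
    using that by metis
  have "i \<ge> 1" "1 / wait_scale c0 c1 i = b" if "i \<in> insert (Suc n) J" for i
    using that by (auto simp: J_def b wait_scale_def)
  with expX have expJ: "distributed M lborel (X i) (exponential_density b)" if "i \<in> insert (Suc n) J" for i
    using that by metis
  have indX: "indep_vars (\<lambda>_. borel) X {1..}"
    unfolding X_def[abs_def] by (rule indep_vars_compose2[OF ind]) simp
  have X: "X i \<in> borel_measurable M" if "i \<ge> 1" for i
    using e[OF that] unfolding X_def[abs_def] by measurable
  have pos: "AE \<omega> in M. \<forall>i. i \<ge> 1 \<longrightarrow> 0 < e i \<omega>" by (rule AE_exponential_seq_pos[OF exp1])
  have [measurable]: "(\<lambda>\<omega>. \<Sum>i\<in>I. X i \<omega>) \<in> borel_measurable M" "(\<lambda>\<omega>. \<Sum>i\<in>J. X i \<omega>) \<in> borel_measurable M"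
    "(\<lambda>\<omega>. \<Sum>i\<in>insert (Suc n) J. X i \<omega>) \<in> borel_measurable M"
    using X by (auto intro!: borel_measurable_sum simp: I_def J_def)
  have [measurable]: "jump_count e c0 c1 t \<in> M \<rightarrow>\<^sub>M count_space UNIV"
    by (rule measurable_jump_count[OF e]) auto
  have [measurable]: "telegraph e c0 c1 t \<in> borel_measurable M" by (rule measurable_telegraph[OF e])
  have "AE \<omega> in M. jump_count e c0 c1 t \<omega> = enat n \<and> telegraph e c0 c1 t \<omega> \<in> A \<longleftrightarrow>
      (\<Sum>i\<in>I. X i \<omega>) \<in> B \<and> (\<Sum>i\<in>I. X i \<omega>) + (\<Sum>i\<in>J. X i \<omega>) \<le> t \<and>
      t < (\<Sum>i\<in>I. X i \<omega>) + (\<Sum>i\<in>insert (Suc n) J. X i \<omega>)"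
    using pos
  proof eventually_elim
    case (elim \<omega>)
    have T: "same_parity_time e c0 c1 n \<omega> = (\<Sum>i\<in>I. X i \<omega>)"
      by (simp add: same_parity_time_def I_def X_def)
    have "{1..n} = I \<union> J" "I \<inter> J = {}" "finite I" "finite J" by (auto simp: I_def J_def)
    then have S: "(\<Sum>i = 1..n. X i \<omega>) = (\<Sum>i\<in>I. X i \<omega>) + (\<Sum>i\<in>J. X i \<omega>)"
      by (simp add: sum.union_disjoint)
    have "jump_count e c0 c1 t \<omega> = enat n \<longleftrightarrow> (\<Sum>i = 1..n. X i \<omega>) \<le> t \<and> t < (\<Sum>i = 1..n. X i \<omega>) + X (Suc n) \<omega>"
      using jump_count_eq_iff[of e \<omega> c0 c1 t n] elim c t by (simp add: X_def)
    moreover have "(\<Sum>i\<in>insert (Suc n) J. X i \<omega>) = X (Suc n) \<omega> + (\<Sum>i\<in>J. X i \<omega>)"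
      by (simp add: J_def)
    moreover have "telegraph e c0 c1 t \<omega> = (-1) ^ n * (t - 2 * (\<Sum>i\<in>I. X i \<omega>))"
      if "jump_count e c0 c1 t \<omega> = enat n"
      using telegraph_eq[of e \<omega> c0 c1 t n] elim c t that unfolding T by simp
    ultimately show ?case unfolding S B_def by auto
  qed
  then have "emeasure M {\<omega> \<in> space M. jump_count e c0 c1 t \<omega> = enat n \<and> telegraph e c0 c1 t \<omega> \<in> A} =
      emeasure M {\<omega> \<in> space M. (\<Sum>i\<in>I. X i \<omega>) \<in> B \<and> (\<Sum>i\<in>I. X i \<omega>) + (\<Sum>i\<in>J. X i \<omega>) \<le> t \<and>
      t < (\<Sum>i\<in>I. X i \<omega>) + (\<Sum>i\<in>insert (Suc n) J. X i \<omega>)}"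
    by (intro emeasure_eq_AE) (elim eventually_mono, simp, measurable)
  also have "\<dots> = (\<integral>\<^sup>+x. ennreal (erlang_density (card I - 1) a x *
      (if t < x then 0 else (b * (t - x)) ^ card J * exp (- b * (t - x)) / fact (card J))) *
      indicator B x \<partial>lborel)"
  proof (rule emeasure_exponential_renewal[OF _ _ _ _ _ _ _ _ expI expJ _ B])
    show "finite I" "finite J" "I \<inter> J = {}" "Suc n \<notin> I" "Suc n \<notin> J" by (auto simp: I_def J_def)
    show "I \<noteq> {}" using n by (auto simp: I_def intro!: exI[of _ n])
    show "a > 0" "b > 0" unfolding a b using wait_scale_pos[OF c] by simp_all
    show "indep_vars (\<lambda>_. borel) X (I \<union> insert (Suc n) J)"
      by (rule indep_vars_subset[OF indX]) (auto simp: I_def J_def)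
  qed
  finally show ?thesis unfolding I_def J_def card_same_parity B_def .
qed

text \<open>
  The common form of the even and the odd case: \<open>m + 1\<close> and \<open>j\<close> are the numbers of completed
  holding times of rate \<open>a\<close> and \<open>b\<close>, and \<open>s\<close> is the velocity at time \<open>t\<close>.
\<close>
lemma (in prob_space) jump_count_telegraph_conditional:
  assumes ind: "indep_vars (\<lambda>_. borel) e {1..}"
    and exp1: "\<And>i. i \<ge> 1 \<Longrightarrow> distributed M lborel (e i) (exponential_density 1)"
    and c: "c0 > 0" "c1 > 0" and t: "t > 0" and n: "n \<ge> 1"
    and a: "a = 1 / wait_scale c0 c1 n" and b: "b = 1 / wait_scale c0 c1 (Suc n)"
    and m: "m = Suc n div 2 - 1" and j: "j = n div 2" and s: "s = (-1) ^ n"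
    and h: "\<And>z. h z = (t - s * z) ^ m * (t + s * z) ^ j * exp (s * (a - b) / 2 * z)"
  shows "\<P>(\<omega> in M. jump_count e c0 c1 t \<omega> = enat n) =
      a ^ Suc m * b ^ j / (2 ^ (m + j + 1) * fact m * fact j) * exp (- (a + b) / 2 * t) * (LBINT z:{-t..t}. h z)"
    and "distributed (given_value M (jump_count e c0 c1 t) (enat n)) lborel (telegraph e c0 c1 t)
      (\<lambda>z. ennreal (indicator {-t..t} z * h z / (LBINT z:{-t..t}. h z)))"
proof -
  have e: "e i \<in> borel_measurable M" if "i \<ge> 1" for i
    using distributed_measurable[OF exp1[OF that]] by simp
  have ab: "a > 0" "b > 0" unfolding a b using wait_scale_pos[OF c] by simp_all
  have s': "s = 1 \<or> s = -1" unfolding s by (simp add: minus_one_power_iff)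
  have cont: "continuous_on {-t..t} h" unfolding h by (intro continuous_intros)
  have nn: "h z \<ge> 0" if "z \<in> {-t..t}" for z using that s' unfolding h by auto
  have ps: "h z > 0" if "z \<in> {-t<..<t}" for z using that s' unfolding h by auto
  have int: "(LBINT z:{-t..t}. h z) = (\<integral>z. indicator {-t..t} z * h z \<partial>lborel)"
    by (simp add: set_lebesgue_integral_def)
  note * = given_value_distributed[where N="jump_count e c0 c1 t" and n="enat n" and Z="telegraph e c0 c1 t"
      and C="a ^ Suc m * b ^ j / (2 ^ (m + j + 1) * fact m * fact j) * exp (- (a + b) / 2 * t)"
      and g="\<lambda>z. indicator {-t..t} z * h z"]
  have law: "emeasure M {\<omega> \<in> space M. jump_count e c0 c1 t \<omega> = enat n \<and> telegraph e c0 c1 t \<omega> \<in> A} =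
      (\<integral>\<^sup>+z. ennreal (a ^ Suc m * b ^ j / (2 ^ (m + j + 1) * fact m * fact j) * exp (- (a + b) / 2 * t) *
      (indicator {-t..t} z * h z)) * indicator A z \<partial>lborel)" if A: "A \<in> sets borel" for A
    unfolding h
    by (rule trans[OF jump_count_telegraph_law[OF ind exp1 c t n a b A, folded m j s]
      nn_integral_erlang_gap_affine[OF s' A]])
  have "jump_count e c0 c1 t \<in> M \<rightarrow>\<^sub>M count_space UNIV" by (rule measurable_jump_count[OF e]) auto
  then have prems: "jump_count e c0 c1 t \<in> M \<rightarrow>\<^sub>M count_space UNIV" "telegraph e c0 c1 t \<in> borel_measurable M"
    "0 < a ^ Suc m * b ^ j / (2 ^ (m + j + 1) * fact m * fact j) * exp (- (a + b) / 2 * t)"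
    "integrable lborel (\<lambda>z. indicator {-t..t} z * h z)" "\<And>z. 0 \<le> indicator {-t..t} z * h z"
    "(\<integral>z. indicator {-t..t} z * h z \<partial>lborel) > 0"
    using ab nn measurable_telegraph[OF e]
      integral_pos_of_pos_on_interval[OF t cont nn ps]
    by (auto simp: indicator_def)
  show "\<P>(\<omega> in M. jump_count e c0 c1 t \<omega> = enat n) =
      a ^ Suc m * b ^ j / (2 ^ (m + j + 1) * fact m * fact j) * exp (- (a + b) / 2 * t) * (LBINT z:{-t..t}. h z)"
    unfolding int by (rule *(1)[OF prems law])
  show "distributed (given_value M (jump_count e c0 c1 t) (enat n)) lborel (telegraph e c0 c1 t)
      (\<lambda>z. ennreal (indicator {-t..t} z * h z / (LBINT z:{-t..t}. h z)))"
    unfolding int by (rule *(2)[OF prems law])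
qed

text \<open>Before the first jump, which has rate \<open>c0\<close>, the velocity is constantly \<open>1\<close>.\<close>
lemma (in prob_space) jump_count_zero_law:
  assumes exp1: "\<And>i. i \<ge> 1 \<Longrightarrow> distributed M lborel (e i) (exponential_density 1)"
    and c: "c0 > 0" "c1 > 0" and t: "t > 0"
  shows "\<P>(\<omega> in M. jump_count e c0 c1 t \<omega> = 0) = exp (- t * c0)"
    and "\<P>(\<omega> in M. telegraph e c0 c1 t \<omega> = t \<bar> jump_count e c0 c1 t \<omega> = 0) = 1"
proof -
  have e: "e i \<in> borel_measurable M" if "i \<ge> 1" for i
    using distributed_measurable[OF exp1[OF that]] by simp
  have [measurable]: "e 1 \<in> borel_measurable M" by (rule e) simp
  have [measurable]: "jump_count e c0 c1 t \<in> M \<rightarrow>\<^sub>M count_space UNIV"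
    by (rule measurable_jump_count[OF e]) auto
  have [measurable]: "telegraph e c0 c1 t \<in> borel_measurable M" by (rule measurable_telegraph[OF e])
  have pos: "AE \<omega> in M. \<forall>i. i \<ge> 1 \<longrightarrow> 0 < e i \<omega>"
    by (rule AE_exponential_seq_pos[OF exp1])
  have "\<P>(\<omega> in M. jump_count e c0 c1 t \<omega> = 0) = \<P>(\<omega> in M. t * c0 < e 1 \<omega>)"
  proof (rule prob_eq_AE)
    show "AE \<omega> in M. jump_count e c0 c1 t \<omega> = 0 \<longleftrightarrow> t * c0 < e 1 \<omega>"
      using pos
    proof eventually_elim
      case (elim \<omega>)
      then show ?case
        using jump_count_eq_iff[of e \<omega> c0 c1 t 0] c t
        by (simp add: zero_enat_def[symmetric] wait_scale_def pos_less_divide_eq)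
    qed
  qed measurable
  also have "\<dots> = exp (- t * c0)"
    using exponential_distributedD_gt[OF exp1[of 1], of "t * c0"] c t by simp
  finally show 0: "\<P>(\<omega> in M. jump_count e c0 c1 t \<omega> = 0) = exp (- t * c0)" .
  have "\<P>(\<omega> in M. telegraph e c0 c1 t \<omega> = t \<and> jump_count e c0 c1 t \<omega> = 0) = \<P>(\<omega> in M. jump_count e c0 c1 t \<omega> = 0)"
  proof (rule prob_eq_AE)
    show "AE \<omega> in M. telegraph e c0 c1 t \<omega> = t \<and> jump_count e c0 c1 t \<omega> = 0 \<longleftrightarrow> jump_count e c0 c1 t \<omega> = 0"
      using pos
    proof eventually_elim
      case (elim \<omega>)
      then show ?case
        using telegraph_eq[of e \<omega> c0 c1 t 0] c t by (auto simp: zero_enat_def[symmetric] same_parity_time_def)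
    qed
  qed measurable
  then show "\<P>(\<omega> in M. telegraph e c0 c1 t \<omega> = t \<bar> jump_count e c0 c1 t \<omega> = 0) = 1"
    unfolding cond_prob_def 0 by simp
qed

theorem proposition3p1:
  fixes M :: "'a measure" and e :: "nat \<Rightarrow> 'a \<Rightarrow> real" and c0 c1 \<tau> \<tau>' t :: real
  assumes "prob_space M"
    and "prob_space.indep_vars M (\<lambda>_. borel) e {1..}"
    and "\<And>n. n \<ge> 1 \<Longrightarrow> distributed M lborel (e n) (exponential_density 1)"
    and "c0 > 0" and "c1 > 0" and "t > 0"
    and "\<tau> = (c0 + c1) / 2" and "\<tau>' = (c1 - c0) / 2"
  shows
    "(\<P>(\<omega> in M. jump_count e c0 c1 t \<omega> = 0) = exp (- t * c0) \<and>
      \<P>(\<omega> in M. telegraph e c0 c1 t \<omega> = t \<bar> jump_count e c0 c1 t \<omega> = 0) = 1) \<and>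
     (\<forall>k\<ge>1.
        \<P>(\<omega> in M. jump_count e c0 c1 t \<omega> = enat (2 * k)) =
          (c0 * c1) ^ k * alpha \<tau>' k t / (2 ^ (2 * k) * fact k * fact (k - 1)) * exp (- \<tau> * t) \<and>
        distributed (given_value M (jump_count e c0 c1 t) (enat (2 * k))) lborel
          (telegraph e c0 c1 t)
          (\<lambda>z. 1 / alpha \<tau>' k t * (t - z) ^ (k - 1) * (t + z) ^ k * exp (\<tau>' * z)
                 * indicator {-t..t} z)) \<and>
     (\<forall>k.
        \<P>(\<omega> in M. jump_count e c0 c1 t \<omega> = enat (2 * k + 1)) =
          c0 ^ (k + 1) * c1 ^ k * alpha_tilde \<tau>' k t / (2 ^ (2 * k + 1) * (fact k)\<^sup>2) * exp (- \<tau> * t) \<and>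
        distributed (given_value M (jump_count e c0 c1 t) (enat (2 * k + 1))) lborel
          (telegraph e c0 c1 t)
          (\<lambda>z. 1 / alpha_tilde \<tau>' k t * (t - z) ^ k * (t + z) ^ k * exp (\<tau>' * z)
                 * indicator {-t..t} z))"
proof -
  interpret prob_space M by fact
  have rate: "- (c1 + c0) / 2 * t = - \<tau> * t" and rate': "- (c0 + c1) / 2 * t = - \<tau> * t"
    by (simp_all add: assms(7) field_simps)
  note zero = jump_count_zero_law[OF assms(3) assms(4-6)]
  have even_case: "\<P>(\<omega> in M. jump_count e c0 c1 t \<omega> = enat (2 * k)) =
        (c0 * c1) ^ k * alpha \<tau>' k t / (2 ^ (2 * k) * fact k * fact (k - 1)) * exp (- \<tau> * t) \<and>
      distributed (given_value M (jump_count e c0 c1 t) (enat (2 * k))) lborel (telegraph e c0 c1 t)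
        (\<lambda>z. 1 / alpha \<tau>' k t * (t - z) ^ (k - 1) * (t + z) ^ k * exp (\<tau>' * z) * indicator {-t..t} z)"
    if k: "k \<ge> 1" for k
  proof -
    \<comment> \<open>The factors \<open>1\<close> keep the shape of the general density, with velocity \<open>s = 1\<close>.\<close>
    define h where "h z = (t - 1 * z) ^ (k - 1) * (t + 1 * z) ^ k * exp (1 * (c1 - c0) / 2 * z)" for z
    have alpha: "alpha \<tau>' k t = (LBINT z:{-t..t}. h z)"
      by (simp add: alpha_def h_def assms(8))
    have "c1 = 1 / wait_scale c0 c1 (2 * k)" "c0 = 1 / wait_scale c0 c1 (Suc (2 * k))"
      "k - 1 = Suc (2 * k) div 2 - 1" "k = 2 * k div 2" "(1 :: real) = (-1) ^ (2 * k)" "1 \<le> 2 * k"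
      using k by (simp_all add: wait_scale_def)
    note L = jump_count_telegraph_conditional[OF assms(2,3) assms(4-6) this(6,1-5) h_def]
    have "\<P>(\<omega> in M. jump_count e c0 c1 t \<omega> = enat (2 * k)) =
        c1 ^ Suc (k - 1) * c0 ^ k / (2 ^ (k - 1 + k + 1) * fact (k - 1) * fact k) * exp (- \<tau> * t) * alpha \<tau>' k t"
      unfolding alpha rate[symmetric] by (rule L(1))
    also have "\<dots> = (c0 * c1) ^ k * alpha \<tau>' k t / (2 ^ (2 * k) * fact k * fact (k - 1)) * exp (- \<tau> * t)"
      using k by (simp add: power_mult_distrib mult_2 mult_ac)
    finally have prob: "\<P>(\<omega> in M. jump_count e c0 c1 t \<omega> = enat (2 * k)) = \<dots>" .
    have dens: "(\<lambda>z. ennreal (1 / alpha \<tau>' k t * (t - z) ^ (k - 1) * (t + z) ^ k * exp (\<tau>' * z) * indicator {-t..t} z)) =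
        (\<lambda>z. ennreal (indicator {-t..t} z * h z / alpha \<tau>' k t))"
      by (simp add: h_def assms(8) mult_ac)
    show ?thesis
      unfolding dens by (rule conjI[OF prob], unfold alpha, rule L(2))
  qed
  have odd_case: "\<P>(\<omega> in M. jump_count e c0 c1 t \<omega> = enat (2 * k + 1)) =
        c0 ^ (k + 1) * c1 ^ k * alpha_tilde \<tau>' k t / (2 ^ (2 * k + 1) * (fact k)\<^sup>2) * exp (- \<tau> * t) \<and>
      distributed (given_value M (jump_count e c0 c1 t) (enat (2 * k + 1))) lborel (telegraph e c0 c1 t)
        (\<lambda>z. 1 / alpha_tilde \<tau>' k t * (t - z) ^ k * (t + z) ^ k * exp (\<tau>' * z) * indicator {-t..t} z)" for k
  proof -
    \<comment> \<open>Velocity \<open>s = -1\<close> exchanges the two linear factors and, with \<open>a\<close> and \<open>b\<close> exchanged, keeps the exponent.\<close>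
    define h where "h z = (t - (-1) * z) ^ k * (t + (-1) * z) ^ k * exp ((-1) * (c0 - c1) / 2 * z)" for z
    have h: "h z = (t - z) ^ k * (t + z) ^ k * exp (\<tau>' * z)" for z
      by (simp add: h_def assms(8) mult_ac)
    have alpha: "alpha_tilde \<tau>' k t = (LBINT z:{-t..t}. h z)"
      by (simp add: alpha_tilde_def h)
    have "c0 = 1 / wait_scale c0 c1 (2 * k + 1)" "c1 = 1 / wait_scale c0 c1 (Suc (2 * k + 1))"
      "k = Suc (2 * k + 1) div 2 - 1" "k = (2 * k + 1) div 2" "(-1 :: real) = (-1) ^ (2 * k + 1)" "1 \<le> 2 * k + 1"
      by (simp_all add: wait_scale_def)
    note L = jump_count_telegraph_conditional[OF assms(2,3) assms(4-6) this(6,1-5) h_def]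
    have "\<P>(\<omega> in M. jump_count e c0 c1 t \<omega> = enat (2 * k + 1)) =
        c0 ^ Suc k * c1 ^ k / (2 ^ (k + k + 1) * fact k * fact k) * exp (- \<tau> * t) * alpha_tilde \<tau>' k t"
      unfolding alpha rate'[symmetric] by (rule L(1))
    also have "\<dots> = c0 ^ (k + 1) * c1 ^ k * alpha_tilde \<tau>' k t / (2 ^ (2 * k + 1) * (fact k)\<^sup>2) * exp (- \<tau> * t)"
      unfolding power2_eq_square mult_2 Suc_eq_plus1 by (simp only: times_divide_eq_left times_divide_eq_right mult_ac)
    finally have prob: "\<P>(\<omega> in M. jump_count e c0 c1 t \<omega> = enat (2 * k + 1)) = \<dots>" .
    have dens: "(\<lambda>z. ennreal (1 / alpha_tilde \<tau>' k t * (t - z) ^ k * (t + z) ^ k * exp (\<tau>' * z) * indicator {-t..t} z)) =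
        (\<lambda>z. ennreal (indicator {-t..t} z * h z / alpha_tilde \<tau>' k t))"
      by (simp add: h mult_ac)
    show ?thesis
      unfolding dens by (rule conjI[OF prob], unfold alpha, rule L(2))
  qed
  show ?thesis
    by (intro conjI[OF conjI[OF zero] conjI] allI impI even_case odd_case)
qed

end
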